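(* Let $n,m\ge 1$ be integers, $\mathcal{X}$ a set of inputs, $\boldsymbol{I}:\mathcal{X}\to\mathbb{R}^n$ the (known) feature map, and let $W_S=(w_{ij})\in\mathbb{R}^{n\times m}$ and $\boldsymbol{b}_S=(b_{S,1},\dots,b_{S,m})\in\mathbb{R}^m$ be the weight matrix and bias vector of the last layer of the student network, whose output is $\mathcal{O}_\theta(\boldsymbol{x})=\mathrm{sigmoid}(\boldsymbol{I}(\boldsymbol{x})^TW_S+\boldsymbol{b}_S)$ (applied componentwise). Let $j_0\in\{1,\dots,m\}$ and let $\boldsymbol{x}\in\mathcal{X}$ be any input. Let $z_{j_0}$ be the correct value of $\mathcal{O}_{\theta,j_0}(\boldsymbol{x})$, and let $\tilde z_{j_0}$ be the value of $\mathcal{O}_{\theta,j_0}(\boldsymbol{x})$ when a SNIFF on the bias $b_{S,j_0}$ is carried out. Then \[ b_{S,j_0}=\frac12\ln\left(\frac{\tilde z_{j_0}^{-1}-1}{z_{j_0}^{-1}-1}\right). \]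
   Context: All computations are in exact real arithmetic. The student network consists of a fixed known feature map $\boldsymbol{I}=(I_1,\dots,I_n):\mathcal{X}\to\mathbb{R}^n$ (the first $k-1$ layers of a public teacher network) followed by one fully connected layer with weights $W_S\in\mathbb{R}^{n\times m}$ and biases $\boldsymbol{b}_S\in\mathbb{R}^m$. For an input $\boldsymbol{x}$, put $y_j(\boldsymbol{x})=b_{S,j}+\sum_{i=1}^n I_i(\boldsymbol{x})w_{ij}$ for $j=1,\dots,m$. With sigmoid activation the $j$-th output is $\mathcal{O}_{\theta,j}(\boldsymbol{x})=1/(1+\exp(-y_j(\boldsymbol{x})))$. SNIFF (sign bit flip fault) on the bias $b_{S,j_0}$: during the execution on $\boldsymbol{x}$, the value $b_{S,j_0}$ is replaced by $-b_{S,j_0}$ in the computation of $y_{j_0}$; everything else is unchanged, and the activation is then applied. *)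

theory Defs
  imports "HOL-Analysis.Analysis"
begin

definition sigmoid :: "real \<Rightarrow> real" where
  "sigmoid y = 1 / (1 + exp (- y))"

(* A weight matrix in R^(n x m) has n rows, hence the type real ^ 'm ^ 'n;
   component j of v v* W is the sum over i of v $ i * W $ i $ j. *)
definition pre_activation ::
  "('x \<Rightarrow> real ^ 'n) \<Rightarrow> real ^ 'm ^ 'n \<Rightarrow> real ^ 'm \<Rightarrow> 'x \<Rightarrow> real ^ 'm" where
  "pre_activation I W b x = I x v* W + b"

definition student_output ::
  "('x \<Rightarrow> real ^ 'n) \<Rightarrow> real ^ 'm ^ 'n \<Rightarrow> real ^ 'm \<Rightarrow> 'x \<Rightarrow> real ^ 'm" where
  "student_output I W b x = (\<chi> j. sigmoid (pre_activation I W b x $ j))"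

definition flip_sign_at :: "'m \<Rightarrow> real ^ 'm \<Rightarrow> real ^ 'm" where
  "flip_sign_at j0 b = (\<chi> j. if j = j0 then - (b $ j) else b $ j)"

(* Output of one execution under a sign bit flip fault (SNIFF) on the bias b $ j0.
   That bias enters only the j0-th pre-activation, so the fault amounts to running
   the layer with the corrupted bias vector. *)
definition student_output_sniff_bias ::
  "'m \<Rightarrow> ('x \<Rightarrow> real ^ 'n) \<Rightarrow> real ^ 'm ^ 'n \<Rightarrow> real ^ 'm \<Rightarrow> 'x \<Rightarrow> real ^ 'm" where
  "student_output_sniff_bias j0 I W b x = student_output I W (flip_sign_at j0 b) x"

end

theory Submission
  imports Defs
begin

lemma inverse_sigmoid: "inverse (sigmoid y) - 1 = exp (- y)"
  by (simp add: sigmoid_def)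

theorem theorem3:
  fixes X :: "'x set"
    and I :: "'x \<Rightarrow> real ^ 'n"
    and W :: "real ^ 'm ^ 'n"
    and b :: "real ^ 'm"
    and j0 :: 'm
    and x :: 'x
    and z z' :: real
  assumes "x \<in> X"
    and "z = student_output I W b x $ j0"
    and "z' = student_output_sniff_bias j0 I W b x $ j0"
  shows "b $ j0 = 1 / 2 * ln ((inverse z' - 1) / (inverse z - 1))"
proof -
  define s where "s = (I x v* W) $ j0"
  have "inverse z - 1 = exp (- (s + b $ j0))"
    by (simp add: assms(2) student_output_def pre_activation_def s_def inverse_sigmoid)
  moreover have "inverse z' - 1 = exp (- (s - b $ j0))"
    by (simp add: assms(3) student_output_sniff_bias_def student_output_def pre_activation_def
        flip_sign_at_def s_def inverse_sigmoid)
  ultimately have "(inverse z' - 1) / (inverse z - 1) = exp (2 * b $ j0)"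
    by (simp flip: exp_diff)
  then show ?thesis
    by simp
qed

end
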